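(* Let $d\ge2$ and let $f:\mathbb{R}^d\to\mathbb{R}$ be a $C^1$ function. For $1\le i\le d$ let $K_i\subset\mathbb{R}$ be the self-similar set of the IFS $\{\phi_{k,i}(x)=r_{k,i}x+a_{k,i}\}_{k=1}^{\ell_i}$, where $r_{k,i}\in(0,1)$, $a_{k,i}\in\mathbb{R}$, $\ell_i\in\mathbb{N}_{\ge2}$, and let $[A_i,B_i]$ be the convex hull of $K_i$. Set $s_{min}:=\min\{r_{k,i}:1\le i\le d,\ 1\le k\le\ell_i\}$. Suppose that for any $(x_1,\dots,x_d)\in[A_1,B_1]\times\cdots\times[A_d,B_d]$, any $1\le i\le d$ and any $1\le k\le\ell_i-1$, $$\begin{cases}\partial_{x_i}f>0,\\ s_{min}\Big(\sum_{j\neq i}(B_j-A_j)\,\partial_{x_j}f\Big)+\big(\phi_{k,i}(B_i)-\phi_{k+1,i}(A_i)\big)\,\partial_{x_i}f\ge0\end{cases}$$ (partial derivatives evaluated at $(x_1,\dots,x_d)$). Then $$f(K_1,\dots,K_d)=\{f(x_1,\dots,x_d):x_i\in K_i,\ 1\le i\le d\}$$ is a union of finitely many closed intervals.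
   Context: The self-similar set (attractor) of a finite family of contractions $\{\phi_k\}_{k=1}^{\ell}$ of $\mathbb{R}$ (an iterated function system, IFS) is the unique nonempty compact set $K\subset\mathbb{R}$ with $K=\bigcup_{k=1}^{\ell}\phi_k(K)$. No separation condition is imposed on the IFS's.
   Formalization: The maps of each IFS are assumed numbered from left to right in the weak sense φ_{k,i}(A_i) ≤ φ_{k+1,i}(B_i) for 1≤k≤ℓ_i−1; without an ordering the claim fails, e.g. f=x+y with both IFS's {x/10+9/10, x/10}. *)

theory Defs
  imports "HOL-Analysis.Analysis"
begin

definition C1_function :: "('a::real_normed_vector \<Rightarrow> 'b::real_normed_vector) \<Rightarrow> bool" where
  "C1_function f \<longleftrightarrow>
     (\<exists>f' :: 'a \<Rightarrow> 'a \<Rightarrow>\<^sub>L 'b.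
        (\<forall>x. (f has_derivative blinfun_apply (f' x)) (at x)) \<and> continuous_on UNIV f')"

definition partial_deriv :: "'d \<Rightarrow> (real ^ 'd \<Rightarrow> real) \<Rightarrow> real ^ 'd \<Rightarrow> real" where
  "partial_deriv i f x = deriv (\<lambda>t. f (x + t *\<^sub>R axis i 1)) 0"

text \<open>For finitely many contractions \<open>\<phi> 1, \<dots>, \<phi> l\<close> with \<open>l \<ge> 1\<close>, exactly one set satisfies this
  predicate, by Hutchinson's theorem.\<close>

definition is_attractor :: "nat \<Rightarrow> (nat \<Rightarrow> real \<Rightarrow> real) \<Rightarrow> real set \<Rightarrow> bool" where
  "is_attractor l \<phi> K \<longleftrightarrow> K \<noteq> {} \<and> compact K \<and> K = (\<Union>k\<in>{1..l}. \<phi> k ` K)"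

text \<open>A condition involving consecutive maps depends on the numbering of the IFS, and it is
  understood that the maps are numbered from left to right.  As the intervals \<open>\<phi> k ` {A..B}\<close> may
  overlap, only this much of that convention is kept: no interval lies strictly to the right of
  its successor.  For increasing maps this follows from numbering by left endpoints, by right
  endpoints, or by fixed points, so every family has such a numbering.\<close>

definition left_to_right :: "nat \<Rightarrow> (nat \<Rightarrow> real \<Rightarrow> real) \<Rightarrow> real \<Rightarrow> real \<Rightarrow> bool" where
  "left_to_right l \<phi> A B \<longleftrightarrow> (\<forall>k\<in>{1..l - 1}. \<phi> k A \<le> \<phi> (k + 1) B)"

text \<open>Closed intervals are bounded, and a single point \<open>{a..a}\<close> counts as one: it does occur
  as a self-similar set, when all maps of the IFS have the same fixed point.\<close>

definition finite_union_of_closed_intervals :: "real set \<Rightarrow> bool" where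
  "finite_union_of_closed_intervals S \<longleftrightarrow>
     (\<exists>F. finite F \<and> (\<forall>J\<in>F. \<exists>a b. a \<le> b \<and> J = {a..b}) \<and> S = \<Union>F)"

end

theory Submission
  imports Defs
begin

text \<open>
  The image is in fact the single interval \<open>[f(A), f(B)]\<close>, where \<open>A\<close> and \<open>B\<close> are the corners of the
  product of the convex hulls.  One inclusion is monotonicity of \<open>f\<close>; for the other, a value \<open>t\<close> of
  this interval is trapped in the images of smaller and smaller cells.

  A cell is a product of intervals \<open>\<lambda>\<^sub>i [A\<^sub>i, B\<^sub>i] + c\<^sub>i\<close> where \<open>x \<mapsto> \<lambda>\<^sub>i x + c\<^sub>i\<close> maps \<open>K\<^sub>i\<close> into
  itself, so that its corners lie in the product of the \<open>K\<^sub>i\<close>.  Let \<open>i\<close> be a direction where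
  \<open>\<lambda>\<^sub>i\<close> is largest, and replace the cell by the subcells obtained by applying the maps of the
  \<open>i\<close>-th IFS in that direction only.  By the mean value theorem, the difference of \<open>f\<close> between
  the top of the \<open>k\<close>-th subcell and the bottom of the next one is, at some point of the big box,
  \<open>\<Sum>\<^sub>j\<^sub>\<noteq>\<^sub>i \<lambda>\<^sub>j (B\<^sub>j - A\<^sub>j) \<partial>\<^sub>jf + \<lambda>\<^sub>i (\<phi>\<^sub>k(B\<^sub>i) - \<phi>\<^sub>k\<^sub>+\<^sub>1(A\<^sub>i)) \<partial>\<^sub>if\<close>.
  The hypothesis makes this nonnegative as soon as \<open>\<lambda>\<^sub>j \<ge> s\<^sub>m\<^sub>i\<^sub>n \<lambda>\<^sub>i\<close> for all \<open>j\<close>, so consecutive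
  subcells have overlapping images (lemma \<open>subcells_overlap\<close>) and one of them still traps \<open>t\<close>
  (lemma \<open>refine_cell\<close>).  Shrinking the largest ratio by a factor at least \<open>s\<^sub>m\<^sub>i\<^sub>n\<close> preserves the
  balance \<open>\<lambda>\<^sub>j \<ge> s\<^sub>m\<^sub>i\<^sub>n \<lambda>\<^sub>i\<close> for all \<open>i, j\<close>, which allows the construction to continue; the
  balance also turns the decay of \<open>\<Prod>\<lambda>\<^sub>i\<close> into decay of every \<open>\<lambda>\<^sub>i\<close>.  The cells therefore shrink to
  points, \<open>t\<close> is a limit of values at corners, and compactness of the \<open>K\<^sub>i\<close> concludes.
\<close>

section \<open>Chains of intervals and mean values\<close>

text \<open>A discrete intermediate value theorem: if no interval contained \<open>t\<close>, each would lie strictly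
  on one side of \<open>t\<close>, and neighbours, which intersect, would lie on the same side.\<close>

lemma chain_of_intervals_covers:
  fixes u v :: "nat \<Rightarrow> real"
  assumes up: "\<And>k. k \<in> {1..n - 1} \<Longrightarrow> u (k + 1) \<le> v k"
    and down: "\<And>k. k \<in> {1..n - 1} \<Longrightarrow> u k \<le> v (k + 1)"
    and p: "p \<in> {1..n}" "u p \<le> t"
    and q: "q \<in> {1..n}" "t \<le> v q"
  shows "\<exists>k\<in>{1..n}. u k \<le> t \<and> t \<le> v k"
proof (rule ccontr)
  assume "\<not> ?thesis"
  then have miss: "v k < t" if "u k \<le> t" "k \<in> {1..n}" for k
    using that by force
  have same_side: "u k \<le> t \<longleftrightarrow> u 1 \<le> t" if "1 \<le> k" "k \<le> n" for k
    using that
  proof (induction k rule: dec_induct)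
    case (step k)
    have "u (Suc k) \<le> v k" "u k \<le> v (Suc k)"
      using up[of k] down[of k] step by auto
    moreover have "u k \<le> t \<Longrightarrow> v k < t" "u (Suc k) \<le> t \<Longrightarrow> v (Suc k) < t"
      using miss[of k] miss[of "Suc k"] step by auto
    ultimately have "u (Suc k) \<le> t \<longleftrightarrow> u k \<le> t" by linarith
    then show ?case using step by simp
  qed simp
  have "u q \<le> t" using same_side[of p] same_side[of q] p q by simp
  then show False using miss[of q] q by simp
qed

text \<open>The hypothesis on \<open>f\<close> compares partial derivatives at one and the same point, so the increment
  must be expressed with a single intermediate point: the one-dimensional theorem is applied along
  the segment from \<open>x\<close> to \<open>y\<close>, not coordinate by coordinate.\<close>

lemma mean_value_coordinates:
  fixes f :: "real ^ 'd \<Rightarrow> real"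
  assumes "convex S" "x \<in> S" "y \<in> S"
    and deriv: "\<And>z. z \<in> S \<Longrightarrow> (f has_derivative (\<lambda>h. \<Sum>i\<in>UNIV. h $ i * D i z)) (at z)"
  shows "\<exists>z\<in>S. f y - f x = (\<Sum>i\<in>UNIV. (y $ i - x $ i) * D i z)"
proof -
  define p where "p t = x + t *\<^sub>R (y - x)" for t :: real
  have p_in: "p t \<in> S" if "t \<in> {0..1}" for t
  proof -
    have "p t = (1 - t) *\<^sub>R x + t *\<^sub>R y" by (simp add: p_def algebra_simps)
    then show ?thesis using that convexD_alt[OF assms(1-3)] by simp
  qed
  have "\<exists>t\<in>{0<..<1}. (f \<circ> p) 1 - (f \<circ> p) 0
          = (\<lambda>h. \<Sum>i\<in>UNIV. (h *\<^sub>R (y - x)) $ i * D i (p t)) (1 - 0)"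
  proof (rule mvt_simple)
    fix t :: real assume "0 \<le> t" "t \<le> 1"
    then have "p t \<in> S" by (simp add: p_in)
    moreover have "(p has_derivative (\<lambda>h. h *\<^sub>R (y - x))) (at t within {0..1})"
      unfolding p_def by (auto intro!: derivative_eq_intros)
    ultimately show "((f \<circ> p) has_derivative
        (\<lambda>h. \<Sum>i\<in>UNIV. (h *\<^sub>R (y - x)) $ i * D i (p t))) (at t within {0..1})"
      unfolding o_def by (intro has_derivative_compose[OF _ deriv])
  qed simp
  then obtain t where "t \<in> {0<..<1}"
    and "f (p 1) - f (p 0) = (\<Sum>i\<in>UNIV. (y $ i - x $ i) * D i (p t))"
    by auto
  moreover have "p 1 = y" "p 0 = x" by (simp_all add: p_def)
  ultimately show ?thesis using p_in[of t] by auto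
qed

lemma C1_function_has_partial_derivatives:
  fixes f :: "real ^ 'd \<Rightarrow> real"
  assumes "C1_function f"
  shows "(f has_derivative (\<lambda>h. \<Sum>i\<in>UNIV. h $ i * partial_deriv i f x)) (at x)"
proof -
  obtain f' where f': "(f has_derivative blinfun_apply (f' x)) (at x)"
    using assms unfolding C1_function_def by blast
  interpret bounded_linear "blinfun_apply (f' x)" by (rule blinfun.bounded_linear_right)
  have partial: "partial_deriv i f x = f' x (axis i 1)" for i
  proof -
    have "((\<lambda>t. x + t *\<^sub>R axis i 1) has_derivative (\<lambda>t. t *\<^sub>R axis i 1)) (at 0)"
      by (auto intro!: derivative_eq_intros)
    then have "((\<lambda>t. f (x + t *\<^sub>R axis i 1)) has_derivative (\<lambda>t. f' x (t *\<^sub>R axis i 1))) (at 0)"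
      by (rule has_derivative_compose) (use f' in simp)
    moreover have "(\<lambda>t. f' x (t *\<^sub>R axis i 1)) = (*) (f' x (axis i 1))"
      by (simp add: fun_eq_iff scaleR)
    ultimately have "((\<lambda>t. f (x + t *\<^sub>R axis i 1)) has_field_derivative f' x (axis i 1)) (at 0)"
      by (simp add: has_field_derivative_def)
    then show ?thesis unfolding partial_deriv_def by (rule DERIV_imp_deriv)
  qed
  have "f' x h = (\<Sum>i\<in>UNIV. h $ i * partial_deriv i f x)" for h
  proof -
    have "f' x h = f' x (\<Sum>i\<in>UNIV. h $ i *s axis i 1)" by (simp add: basis_expansion)
    then show ?thesis by (simp add: sum scalar_mult_eq_scaleR scaleR partial)
  qed
  then have "blinfun_apply (f' x) = (\<lambda>h. \<Sum>i\<in>UNIV. h $ i * partial_deriv i f x)" by blast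
  then show ?thesis using f' by simp
qed

lemma convex_hull_endpoints:
  fixes K :: "real set"
  assumes "K \<noteq> {}" and hull: "convex hull K = {A..B}"
  shows "A \<in> K" "B \<in> K" "K \<subseteq> {A..B}"
proof -
  show "K \<subseteq> {A..B}" using hull_subset[of K convex] hull by simp
  then have "A \<le> B" using \<open>K \<noteq> {}\<close> by auto
  then have "A extreme_point_of {A..B}" "B extreme_point_of {A..B}"
    by (auto simp: extreme_point_of_segment closed_segment_eq_real_ivl1[symmetric])
  then show "A \<in> K" "B \<in> K"
    using extreme_point_of_convex_hull[of _ K] hull by auto
qed

section \<open>Balanced cells\<close>

definition box_point :: "('d \<Rightarrow> real) \<Rightarrow> ('d \<Rightarrow> real) \<Rightarrow> ('d \<Rightarrow> real) \<Rightarrow> real ^ 'd" where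
  "box_point lam c P = (\<chi> i. lam i * P i + c i)"

lemma box_point_nth [simp]: "box_point lam c P $ i = lam i * P i + c i"
  by (simp add: box_point_def)

text \<open>The function \<open>D i\<close> stands for the \<open>i\<close>-th partial derivative of \<open>f\<close>, \<open>s\<close> for a lower and
  \<open>\<rho>\<close> for an upper bound of the contraction ratios.\<close>

locale linked_ifs_product =
  fixes f :: "real ^ 'd \<Rightarrow> real"
    and D :: "'d \<Rightarrow> real ^ 'd \<Rightarrow> real"
    and l :: "'d \<Rightarrow> nat"
    and r a :: "nat \<Rightarrow> 'd \<Rightarrow> real"
    and K :: "'d \<Rightarrow> real set"
    and A B :: "'d \<Rightarrow> real"
    and s \<rho> :: real
  assumes ratio_bounds: "0 < s" "\<rho> < 1" "\<And>i k. k \<in> {1..l i} \<Longrightarrow> s \<le> r k i \<and> r k i \<le> \<rho>"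
    and compact_K: "\<And>i. compact (K i)"
    and K_eq: "\<And>i. K i = (\<Union>k\<in>{1..l i}. (\<lambda>x. r k i * x + a k i) ` K i)"
    and ends: "\<And>i. A i \<in> K i" "\<And>i. B i \<in> K i" "\<And>i. K i \<subseteq> {A i..B i}"
    and ordered: "\<And>i k. k \<in> {1..l i - 1} \<Longrightarrow>
        r k i * A i + a k i \<le> r (k + 1) i * B i + a (k + 1) i"
    and deriv: "\<And>x. x \<in> {x. \<forall>j. x $ j \<in> {A j..B j}} \<Longrightarrow>
        (f has_derivative (\<lambda>h. \<Sum>i\<in>UNIV. h $ i * D i x)) (at x)"
    and D_pos: "\<And>x i. x \<in> {x. \<forall>j. x $ j \<in> {A j..B j}} \<Longrightarrow> 0 < D i x"
    and linked: "\<And>x i k. x \<in> {x. \<forall>j. x $ j \<in> {A j..B j}} \<Longrightarrow> k \<in> {1..l i - 1} \<Longrightarrow>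
        0 \<le> s * (\<Sum>j\<in>UNIV - {i}. (B j - A j) * D j x)
            + ((r k i * B i + a k i) - (r (k + 1) i * A i + a (k + 1) i)) * D i x"
begin

abbreviation hull_box :: "(real ^ 'd) set" where
  "hull_box \<equiv> {x. \<forall>j. x $ j \<in> {A j..B j}}"

lemma A_le_B: "A i \<le> B i"
  using ends[of i] by auto

lemma hull_box_eq_cbox: "hull_box = cbox (\<chi> i. A i) (\<chi> i. B i)"
  by (auto simp: mem_box_cart)

lemma mean_value:
  assumes "x \<in> hull_box" "y \<in> hull_box"
  shows "\<exists>z\<in>hull_box. f y - f x = (\<Sum>i\<in>UNIV. (y $ i - x $ i) * D i z)"
  using assms deriv unfolding hull_box_eq_cbox
  by (intro mean_value_coordinates) auto

lemma f_mono:
  assumes "x \<in> hull_box" "y \<in> hull_box" "\<And>i. x $ i \<le> y $ i"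
  shows "f x \<le> f y"
proof -
  obtain z where z: "z \<in> hull_box" "f y - f x = (\<Sum>i\<in>UNIV. (y $ i - x $ i) * D i z)"
    using mean_value assms(1,2) by blast
  have "0 \<le> (\<Sum>i\<in>UNIV. (y $ i - x $ i) * D i z)"
    using assms(3) D_pos[OF z(1)] by (intro sum_nonneg mult_nonneg_nonneg) (auto intro: less_imp_le)
  then show ?thesis using z(2) by simp
qed

text \<open>The second condition is the balance that makes consecutive subcells overlap; it bounds every
  quotient of two ratios by \<open>1 / s\<close>.\<close>

definition cell :: "('d \<Rightarrow> real) \<Rightarrow> ('d \<Rightarrow> real) \<Rightarrow> bool" where
  "cell lam c \<longleftrightarrow> (\<forall>i. 0 < lam i) \<and> (\<forall>i j. s * lam i \<le> lam j)
     \<and> (\<forall>i. \<forall>x\<in>K i. lam i * x + c i \<in> K i)"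

definition traps :: "real \<Rightarrow> ('d \<Rightarrow> real) \<Rightarrow> ('d \<Rightarrow> real) \<Rightarrow> bool" where
  "traps t lam c \<longleftrightarrow> f (box_point lam c A) \<le> t \<and> t \<le> f (box_point lam c B)"

definition sub_ratio :: "('d \<Rightarrow> real) \<Rightarrow> 'd \<Rightarrow> nat \<Rightarrow> 'd \<Rightarrow> real" where
  "sub_ratio lam i k = lam(i := lam i * r k i)"

definition sub_offset :: "('d \<Rightarrow> real) \<Rightarrow> ('d \<Rightarrow> real) \<Rightarrow> 'd \<Rightarrow> nat \<Rightarrow> 'd \<Rightarrow> real" where
  "sub_offset lam c i k = c(i := lam i * a k i + c i)"

lemma subcell_nth:
  "sub_ratio lam i k j * x + sub_offset lam c i k j
     = lam j * (if j = i then r k i * x + a k i else x) + c j"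
  by (simp add: sub_ratio_def sub_offset_def algebra_simps)

lemma K_maps: "k \<in> {1..l i} \<Longrightarrow> x \<in> K i \<Longrightarrow> r k i * x + a k i \<in> K i"
  by (subst K_eq) auto

lemma r_pos: "k \<in> {1..l i} \<Longrightarrow> 0 < r k i"
  using ratio_bounds(1,3) by force

lemma s_le_\<rho>: "s \<le> \<rho>"
proof -
  obtain k where "k \<in> {1..l undefined}"
    using ends(1)[of undefined] by (subst (asm) K_eq) auto
  then show ?thesis using ratio_bounds(3) by force
qed

lemma cell_in_hull_box:
  assumes "cell lam c"
  shows "box_point lam c A \<in> hull_box" "box_point lam c B \<in> hull_box"
proof -
  have "box_point lam c A $ j \<in> K j" "box_point lam c B $ j \<in> K j" for j
    using assms ends by (simp_all add: cell_def)
  then show "box_point lam c A \<in> hull_box" "box_point lam c B \<in> hull_box"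
    using ends(3) by blast+
qed

text \<open>The balance survives because only the largest ratio is made smaller, and it stays at least
  \<open>s\<close> times the old maximum.\<close>

lemma cell_subcell:
  assumes cell: "cell lam c" and largest: "\<And>j. lam j \<le> lam i" and k: "k \<in> {1..l i}"
  shows "cell (sub_ratio lam i k) (sub_offset lam c i k)"
  unfolding cell_def
proof (intro conjI allI ballI)
  have pos: "\<And>j. 0 < lam j" and balanced: "\<And>j m. s * lam j \<le> lam m"
    and maps: "\<And>j x. x \<in> K j \<Longrightarrow> lam j * x + c j \<in> K j"
    using cell by (auto simp: cell_def)
  have r: "0 < r k i" "s \<le> r k i" "r k i \<le> 1"
    using ratio_bounds k r_pos by force+
  show "0 < sub_ratio lam i k j" for j
    using pos r by (simp add: sub_ratio_def)
  have smaller: "sub_ratio lam i k j \<le> lam i" for j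
    using largest pos r(3) mult_left_le[of "r k i" "lam i"] by (simp add: sub_ratio_def less_imp_le)
  have bound: "s * lam i \<le> sub_ratio lam i k m" for m
    using balanced[of i m] mult_right_mono[OF r(2), of "lam i"] pos[of i]
    by (simp add: sub_ratio_def mult.commute)
  show "s * sub_ratio lam i k j \<le> sub_ratio lam i k m" for j m
    using mult_left_mono[OF smaller[of j], of s] ratio_bounds(1) bound[of m] by linarith
  show "sub_ratio lam i k j * x + sub_offset lam c i k j \<in> K j" if "x \<in> K j" for j x
    using that k unfolding subcell_nth by (auto intro!: maps K_maps)
qed

text \<open>The lengths of the other sides of the cell are at least \<open>s * lam i\<close> times those of the full
  box, so the increase of \<open>f\<close> along them compensates for the gap in direction \<open>i\<close>, which is
  \<open>lam i\<close> times a gap between two images of \<open>[A i, B i]\<close>.\<close>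

lemma subcells_overlap:
  assumes cell: "cell lam c" and largest: "\<And>j. lam j \<le> lam i" and k: "k \<in> {1..l i - 1}"
  shows "f (box_point (sub_ratio lam i (k + 1)) (sub_offset lam c i (k + 1)) A)
       \<le> f (box_point (sub_ratio lam i k) (sub_offset lam c i k) B)"
    (is "f ?x \<le> f ?y")
proof -
  have "?x \<in> hull_box" "?y \<in> hull_box"
    using cell_in_hull_box cell_subcell[OF cell largest] k by auto
  then obtain z where z: "z \<in> hull_box"
    and diff: "f ?y - f ?x = (\<Sum>j\<in>UNIV. (?y $ j - ?x $ j) * D j z)"
    using mean_value by blast
  define g where "g = (r k i * B i + a k i) - (r (k + 1) i * A i + a (k + 1) i)"
  have side: "?y $ j - ?x $ j = lam j * (if j = i then g else B j - A j)" for j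
    unfolding box_point_nth subcell_nth by (simp add: g_def algebra_simps)
  have "(\<Sum>j\<in>UNIV. (?y $ j - ?x $ j) * D j z)
      = (?y $ i - ?x $ i) * D i z + (\<Sum>j\<in>UNIV - {i}. (?y $ j - ?x $ j) * D j z)"
    by (simp add: sum.remove)
  also have "\<dots> = lam i * g * D i z + (\<Sum>j\<in>UNIV - {i}. lam j * (B j - A j) * D j z)"
    unfolding side by simp
  also have "\<dots> \<ge> lam i * g * D i z + (\<Sum>j\<in>UNIV - {i}. (s * lam i) * (B j - A j) * D j z)"
    using cell A_le_B D_pos[OF z]
    by (intro add_left_mono sum_mono mult_right_mono) (auto simp: cell_def intro: less_imp_le)
  also have "lam i * g * D i z + (\<Sum>j\<in>UNIV - {i}. (s * lam i) * (B j - A j) * D j z)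
      = lam i * (s * (\<Sum>j\<in>UNIV - {i}. (B j - A j) * D j z) + g * D i z)"
    by (simp add: sum_distrib_left algebra_simps)
  also have "\<dots> \<ge> 0"
    using cell linked[OF z k] by (simp add: cell_def g_def less_imp_le)
  finally show ?thesis using diff by simp
qed

text \<open>The images of the subcells form a chain in which neighbours meet: \<open>subcells_overlap\<close> gives one
  inequality and the left-to-right numbering the other.\<close>

lemma refine_cell:
  assumes cell: "cell lam c" and trap: "traps t lam c"
  shows "\<exists>lam' c'. cell lam' c' \<and> traps t lam' c' \<and> prod lam' UNIV \<le> \<rho> * prod lam UNIV"
proof -
  have "Max (range lam) \<in> range lam" by (intro Max_in) auto
  then obtain i where "Max (range lam) = lam i" by blast
  then have largest: "\<And>j. lam j \<le> lam i" by (metis Max_ge finite finite_imageI rangeI)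
  have pos: "\<And>j. 0 < lam j" using cell by (simp add: cell_def)
  let ?P = "\<lambda>k E. box_point (sub_ratio lam i k) (sub_offset lam c i k) E"
  have sub: "cell (sub_ratio lam i k) (sub_offset lam c i k)" if "k \<in> {1..l i}" for k
    using cell_subcell cell largest that by blast
  have in_box: "?P k A \<in> hull_box" "?P k B \<in> hull_box" if "k \<in> {1..l i}" for k
    using cell_in_hull_box sub[OF that] by auto
  \<comment> \<open>The extreme subcells need not be the first and the last one; they are found from the maps
    whose images contain the end points of the hull.\<close>
  obtain p x where p: "p \<in> {1..l i}" "x \<in> K i" "A i = r p i * x + a p i"
    using ends(1)[of i] by (subst (asm) K_eq) auto
  have pA: "r p i * A i + a p i \<le> A i"
    using p ends(3)[of i] r_pos[OF p(1)] by auto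
  have "f (?P p A) \<le> f (box_point lam c A)"
    using in_box p(1) cell_in_hull_box[OF cell] pA pos
    by (intro f_mono) (auto simp: subcell_nth)
  then have lower: "f (?P p A) \<le> t" using trap by (simp add: traps_def)
  obtain q y where q: "q \<in> {1..l i}" "y \<in> K i" "B i = r q i * y + a q i"
    using ends(2)[of i] by (subst (asm) K_eq) auto
  have qB: "B i \<le> r q i * B i + a q i"
    using q ends(3)[of i] r_pos[OF q(1)] by auto
  have "f (box_point lam c B) \<le> f (?P q B)"
    using in_box q(1) cell_in_hull_box[OF cell] qB pos
    by (intro f_mono) (auto simp: subcell_nth)
  then have upper: "t \<le> f (?P q B)" using trap by (simp add: traps_def)
  have "f (?P k A) \<le> f (?P (k + 1) B)" if "k \<in> {1..l i - 1}" for k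
  proof (rule f_mono)
    show "?P k A \<in> hull_box" "?P (k + 1) B \<in> hull_box"
      by (rule in_box(1), use that in force) (rule in_box(2), use that in force)
    show "?P k A $ j \<le> ?P (k + 1) B $ j" for j
      unfolding box_point_nth subcell_nth using ordered[OF that] A_le_B pos
      by (simp add: less_imp_le)
  qed
  with subcells_overlap[OF cell largest]
  have "\<exists>k\<in>{1..l i}. f (?P k A) \<le> t \<and> t \<le> f (?P k B)"
    by (rule chain_of_intervals_covers[where p = p and q = q]) (assumption | rule p(1) lower q(1) upper)+
  then obtain k where k: "k \<in> {1..l i}" "f (?P k A) \<le> t" "t \<le> f (?P k B)"
    by blast
  have "prod (sub_ratio lam i k) UNIV = sub_ratio lam i k i * prod (sub_ratio lam i k) (UNIV - {i})"
    by (simp add: prod.remove)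
  also have "prod (sub_ratio lam i k) (UNIV - {i}) = prod lam (UNIV - {i})"
    by (intro prod.cong) (auto simp: sub_ratio_def)
  also have "sub_ratio lam i k i * \<dots> = r k i * prod lam UNIV"
    by (simp add: sub_ratio_def prod.remove[of UNIV i])
  also have "\<dots> \<le> \<rho> * prod lam UNIV"
    using ratio_bounds(3)[OF k(1)] pos by (intro mult_right_mono prod_nonneg) (auto intro: less_imp_le)
  finally show ?thesis using sub[OF k(1)] k by (auto simp: traps_def)
qed

section \<open>Shrinking cells\<close>

lemma cells_with_small_product:
  assumes "traps t (\<lambda>_. 1) (\<lambda>_. 0)"
  shows "\<exists>lam c. cell lam c \<and> traps t lam c \<and> prod lam UNIV \<le> \<rho> ^ n"
proof (induction n)
  case 0
  have "s \<le> 1" using s_le_\<rho> ratio_bounds(2) by simp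
  then have "cell (\<lambda>_. 1) (\<lambda>_. 0)" by (simp add: cell_def)
  then show ?case using assms by (intro exI[of _ "\<lambda>_. 1"] exI[of _ "\<lambda>_. 0"]) simp
next
  case (Suc n)
  then obtain lam c where *: "cell lam c" "traps t lam c" "prod lam UNIV \<le> \<rho> ^ n" by blast
  have "0 \<le> \<rho>" using s_le_\<rho> ratio_bounds(1) by simp
  then show ?case
    using refine_cell[OF *(1,2)] mult_left_mono[OF *(3)] by (metis order.trans power_Suc)
qed

text \<open>Repeated refinement makes only the product of the ratios visibly small.  By balance, \<open>(s * lam i) ^ CARD('d)\<close> is at most
  that product, so every single ratio is small as well.\<close>

lemma small_cells:
  assumes "traps t (\<lambda>_. 1) (\<lambda>_. 0)" and "0 < \<epsilon>"
  shows "\<exists>lam c. cell lam c \<and> traps t lam c \<and> (\<forall>i. lam i < \<epsilon>)"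
proof -
  have "0 < (s * \<epsilon>) ^ CARD('d)" using ratio_bounds(1) assms(2) by simp
  then obtain n where n: "\<rho> ^ n < (s * \<epsilon>) ^ CARD('d)"
    using real_arch_pow_inv ratio_bounds(2) by blast
  obtain lam c where *: "cell lam c" "traps t lam c" "prod lam UNIV \<le> \<rho> ^ n"
    using cells_with_small_product[OF assms(1)] by blast
  have "lam i < \<epsilon>" for i
  proof (rule ccontr)
    assume "\<not> lam i < \<epsilon>"
    then have "s * \<epsilon> \<le> s * lam i" using ratio_bounds(1) by (intro mult_left_mono) auto
    moreover have "s * lam i \<le> lam j" for j using *(1) by (simp add: cell_def)
    ultimately have "s * \<epsilon> \<le> lam j" for j by (rule order.trans)
    then have "(\<Prod>j\<in>(UNIV :: 'd set). s * \<epsilon>) \<le> prod lam UNIV"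
      using ratio_bounds(1) assms(2) by (intro prod_mono) auto
    then show False using n *(3) by simp
  qed
  then show ?thesis using * by blast
qed

lemma image_eq_interval:
  "f ` {x. \<forall>i. x $ i \<in> K i} = {f (\<chi> i. A i)..f (\<chi> i. B i)}" (is "f ` ?K = {?lo..?hi}")
proof (rule subset_antisym)
  have sub: "?K \<subseteq> hull_box" using ends(3) by blast
  have corners: "(\<chi> i. A i) \<in> hull_box" "(\<chi> i. B i) \<in> hull_box" using A_le_B by auto
  show "f ` ?K \<subseteq> {?lo..?hi}"
  proof
    fix u assume "u \<in> f ` ?K"
    then obtain x where "x \<in> hull_box" "u = f x" using sub by blast
    then show "u \<in> {?lo..?hi}" using corners by (auto intro!: f_mono)
  qed
  have cont: "continuous_on hull_box f"
    using deriv by (meson continuous_at_imp_continuous_on has_derivative_continuous)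
  have compact_box: "compact hull_box" unfolding hull_box_eq_cbox by (rule compact_cbox)
  have "closed ?K"
    by (intro closed_Collect_all closed_vimage[unfolded vimage_def] compact_imp_closed compact_K
        continuous_intros)
  then have "compact ?K" using compact_Int_closed[OF compact_box, of ?K] sub by (simp add: Int_absorb1)
  then have closed: "closed (f ` ?K)"
    using cont sub by (intro compact_imp_closed compact_continuous_image) (auto intro: continuous_on_subset)
  \<comment> \<open>The lower corners of small cells trapping \<open>t\<close> lie in the product of the \<open>K i\<close>, and their values
    approximate \<open>t\<close> by uniform continuity.\<close>
  show "{?lo..?hi} \<subseteq> f ` ?K"
  proof
    fix t assume t: "t \<in> {?lo..?hi}"
    then have trap: "traps t (\<lambda>_. 1) (\<lambda>_. 0)" by (simp add: traps_def box_point_def)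
    have "\<exists>u\<in>f ` ?K. dist u t < e" if "0 < e" for e
    proof -
      obtain \<delta> where "0 < \<delta>" and
        \<delta>: "\<And>x y. x \<in> hull_box \<Longrightarrow> y \<in> hull_box \<Longrightarrow> dist y x < \<delta> \<Longrightarrow> dist (f y) (f x) < e"
        using compact_uniformly_continuous[OF cont compact_box] \<open>0 < e\<close>
        unfolding uniformly_continuous_on_def by blast
      \<comment> \<open>The summand 1 keeps \<open>L\<close> positive when all \<open>K i\<close> are single points.\<close>
      define L where "L = 1 + (\<Sum>i\<in>UNIV. B i - A i)"
      have "L > 0" using A_le_B by (auto simp: L_def intro!: add_pos_nonneg sum_nonneg)
      then obtain lam c where cell: "cell lam c" "traps t lam c" and small: "\<And>i. lam i < \<delta> / L"
        using small_cells[OF trap, of "\<delta> / L"] \<open>0 < \<delta>\<close> by auto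
      let ?x = "box_point lam c A" and ?y = "box_point lam c B"
      have "norm (?y - ?x) \<le> (\<Sum>i\<in>UNIV. \<bar>(?y - ?x) $ i\<bar>)" by (rule norm_le_l1_cart)
      also have "\<dots> = (\<Sum>i\<in>UNIV. lam i * (B i - A i))"
        using cell(1) A_le_B
        by (intro sum.cong) (auto simp: cell_def abs_mult less_imp_le simp flip: right_diff_distrib)
      also have "\<dots> \<le> (\<Sum>i\<in>UNIV. \<delta> / L * (B i - A i))"
        using small A_le_B by (intro sum_mono mult_right_mono) (auto intro: less_imp_le)
      also have "\<dots> = \<delta> / L * (L - 1)" by (simp add: L_def sum_distrib_left)
      also have "\<dots> < \<delta>" using \<open>0 < L\<close> \<open>0 < \<delta>\<close> by (simp add: field_simps)
      finally have "dist (f ?y) (f ?x) < e"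
        using \<delta> cell_in_hull_box[OF cell(1)] by (simp add: dist_norm)
      then have "dist (f ?x) t < e" using cell(2) by (simp add: traps_def dist_real_def)
      moreover have "?x \<in> ?K" using cell(1) ends by (simp add: cell_def)
      ultimately show ?thesis by blast
    qed
    then have "t \<in> closure (f ` ?K)" by (simp add: closure_approachable)
    then show "t \<in> f ` ?K" using closed by (simp add: closure_closed)
  qed
qed

end

theorem theorem1p9:
  fixes f :: "real ^ 'd \<Rightarrow> real"
    and l :: "'d \<Rightarrow> nat"
    and r a :: "nat \<Rightarrow> 'd \<Rightarrow> real"
    and \<phi> :: "nat \<Rightarrow> 'd \<Rightarrow> real \<Rightarrow> real"
    and K :: "'d \<Rightarrow> real set"
    and A B :: "'d \<Rightarrow> real"
    and s_min :: real
  assumes "CARD('d) \<ge> 2"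
    and "C1_function f"
    and "\<And>i. l i \<ge> 2"
    and "\<And>i k. k \<in> {1..l i} \<Longrightarrow> 0 < r k i \<and> r k i < 1"
    and "\<And>i k x. \<phi> k i x = r k i * x + a k i"
    and "\<And>i. is_attractor (l i) (\<lambda>k. \<phi> k i) (K i)"
    and "\<And>i. convex hull (K i) = {A i..B i}"
    and "\<And>i. left_to_right (l i) (\<lambda>k. \<phi> k i) (A i) (B i)"
    and "s_min = Min {r k i | k i. k \<in> {1..l i}}"
    and "\<And>x i k. (\<And>j. x $ j \<in> {A j..B j}) \<Longrightarrow> k \<in> {1..l i - 1} \<Longrightarrow>
           partial_deriv i f x > 0 \<and>
           s_min * (\<Sum>j\<in>UNIV - {i}. (B j - A j) * partial_deriv j f x)
             + (\<phi> k i (B i) - \<phi> (k + 1) i (A i)) * partial_deriv i f x \<ge> 0"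
  shows "finite_union_of_closed_intervals (f ` {x. \<forall>i. x $ i \<in> K i})"
proof -
  define R where "R = {r k i | k i. k \<in> {1..l i}}"
  have R_eq: "R = (\<Union>i. (\<lambda>k. r k i) ` {1..l i})" unfolding R_def by blast
  have "finite R" unfolding R_eq by simp
  moreover have r_in_R: "r k i \<in> R" if "k \<in> {1..l i}" for k i
    using that by (auto simp: R_def)
  moreover have "r 1 undefined \<in> R" using r_in_R[of 1 undefined] assms(3)[of undefined] by simp
  then have "R \<noteq> {}" by blast
  ultimately have bounds: "s_min \<in> R" "Max R \<in> R"
      "\<And>i k. k \<in> {1..l i} \<Longrightarrow> s_min \<le> r k i \<and> r k i \<le> Max R"
    unfolding assms(9) R_def[symmetric] by simp_all
  have attractor: "K i \<noteq> {}" "compact (K i)" "K i = (\<Union>k\<in>{1..l i}. \<phi> k i ` K i)" for i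
    using assms(6)[of i] by (simp_all add: is_attractor_def)
  have \<phi>: "\<phi> k i = (\<lambda>x. r k i * x + a k i)" for k i
    using assms(5) by auto
  interpret linked_ifs_product f "\<lambda>i. partial_deriv i f" l r a K A B s_min "Max R"
  proof
    show "0 < s_min" "Max R < 1" using bounds(1,2) assms(4) by (auto simp: R_def)
    show "K i = (\<Union>k\<in>{1..l i}. (\<lambda>x. r k i * x + a k i) ` K i)" for i
      using attractor(3)[of i] by (simp add: \<phi>)
    show "A i \<in> K i" "B i \<in> K i" "K i \<subseteq> {A i..B i}" for i
      using convex_hull_endpoints[OF attractor(1) assms(7)] by auto
    show "r k i * A i + a k i \<le> r (k + 1) i * B i + a (k + 1) i" if "k \<in> {1..l i - 1}" for i k
      using assms(8)[of i] that by (simp add: left_to_right_def \<phi>)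
    show "0 < partial_deriv i f x" if "x \<in> {x. \<forall>j. x $ j \<in> {A j..B j}}" for x i
      using assms(10)[of x 1 i] assms(3)[of i] that by simp
    show "0 \<le> s_min * (\<Sum>j\<in>UNIV - {i}. (B j - A j) * partial_deriv j f x)
        + ((r k i * B i + a k i) - (r (k + 1) i * A i + a (k + 1) i)) * partial_deriv i f x"
      if "x \<in> {x. \<forall>j. x $ j \<in> {A j..B j}}" "k \<in> {1..l i - 1}" for x i k
      using assms(10)[of x k i] that by (simp add: \<phi>)
  qed (use bounds(3) attractor(2) C1_function_has_partial_derivatives[OF assms(2)] in auto)
  have "f (\<chi> i. A i) \<le> f (\<chi> i. B i)" using A_le_B by (intro f_mono) auto
  then show ?thesis
    unfolding finite_union_of_closed_intervals_def image_eq_interval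
    by (intro exI[of _ "{{f (\<chi> i. A i)..f (\<chi> i. B i)}}"]) auto
qed

end
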